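(* Let $d\ge1$, $r\ge2$ and $k$ be integers with $\lceil r/2\rceil<k\le r$. Then there exist pairwise disjoint finite point sets $C_0,C_1,\dots,C_d\subseteq\mathbb{R}^d$, where $|C_1|=\dots=|C_d|=r$ and $|C_0|=r-1$, such that for any $r$ pairwise disjoint sets $X_1,\dots,X_r\subseteq C_0\cup C_1\cup\dots\cup C_d$ with $|X_i\cap C_j|\le1$ for all $i$ and $j$, there are $k$ indices $i_1<\dots<i_k$ with $\operatorname{conv}(X_{i_1})\cap\dots\cap\operatorname{conv}(X_{i_k})=\emptyset$. *)

theory Defs
  imports "HOL-Analysis.Analysis" "HOL-Library.Disjoint_Sets"
begin

end

theory Submission imports Defs begin

text \<open>Put the colour classes \<open>C\<^sub>1, \<dots>, C\<^sub>d\<close> on the \<open>d\<close> coordinate axes at distance at least \<open>1\<close>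
  from the origin, each split as evenly as possible between the two half-axes, and put \<open>C\<^sub>0\<close> very
  close to the origin. Some \<open>X\<^sub>i\<close> misses \<open>C\<^sub>0\<close>, so it lies in a facet of a cross-polytope and every
  point \<open>x\<close> of its hull has a coordinate \<open>a\<close> that is at least \<open>1/d\<close> towards the point of \<open>X\<^sub>i\<close>
  on the \<open>a\<close>-axis. If \<open>x\<close> also lies in the hull of another \<open>X\<^sub>j\<close>, then \<open>X\<^sub>j\<close> must contain a point
  on the same half-axis, and only \<open>\<lceil>r/2\<rceil> < k\<close> points are available there.\<close>

text \<open>The values run 1, -2, 3, -4, ...: the sign follows the parity, which gives the even
  split between the half-axes, and the absolute values are distinct and at least 1.\<close>

definition alt :: "nat \<Rightarrow> real" where
  "alt m = (if even m then real m + 1 else - (real m + 1))"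

definition axis_class :: "nat \<Rightarrow> 'n::finite \<Rightarrow> (real ^ 'n) set" where
  "axis_class r a = (\<lambda>m. axis a (alt m)) ` {..<r}"

text \<open>Points on the positive main diagonal. The summand 2 keeps every coordinate strictly
  below \<open>1 / real CARD('n)\<close>, also for \<open>m = 0\<close>; this is the threshold that
  tells core points from far ones.\<close>

definition core_point :: "nat \<Rightarrow> real ^ 'n::finite" where
  "core_point m = (\<chi> i. 1 / (real CARD('n) * (real m + 2)))"

definition core_class :: "nat \<Rightarrow> (real ^ 'n::finite) set" where
  "core_class r = core_point ` {..<r - 1}"

lemma abs_alt: "\<bar>alt m\<bar> = real m + 1"
  by (auto simp: alt_def)

lemma alt_nonzero [simp]: "alt m \<noteq> 0"
  by (auto simp: alt_def)

lemma inj_alt: "inj alt"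
  by (rule injI) (metis abs_alt add_right_cancel of_nat_eq_iff)

text \<open>The sign fixes the parity of \<open>m\<close>, and halving is injective on numbers of
  one parity. The bound is r/2 rounded up.\<close>

lemma card_alt_sign:
  assumes "s \<in> {1, -1}"
  shows "card {m. m < r \<and> s * alt m > 0} \<le> (r + 1) div 2"
proof -
  let ?A = "{m. m < r \<and> s * alt m > 0}"
  have parity: "even m \<longleftrightarrow> s = 1" if "m \<in> ?A" for m
    using that assms by (auto simp: alt_def split: if_splits)
  have "inj_on (\<lambda>m. m div 2) ?A"
  proof (rule inj_onI)
    fix m n assume mn: "m \<in> ?A" "n \<in> ?A" "m div 2 = n div 2"
    then have "even m \<longleftrightarrow> even n"
      using parity by blast
    with mn(3) show "m = n"
      by presburger
  qed
  moreover have "(\<lambda>m. m div 2) ` ?A \<subseteq> {..<(r + 1) div 2}"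
    by auto
  ultimately have "card ?A \<le> card {..<(r + 1) div 2}"
    by (intro card_inj_on_le) auto
  then show ?thesis by simp
qed

lemma card_axis_class: "card (axis_class r a) = r"
proof -
  have "inj_on (\<lambda>m. axis a (alt m)) {..<r}"
    by (auto simp: inj_on_def axis_eq_axis dest: injD[OF inj_alt])
  then show ?thesis
    by (simp add: axis_class_def card_image)
qed

lemma core_point_bounds: "0 < core_point m $ i" "core_point m $ i < 1 / real CARD('n)"
  for i :: "'n::finite"
  by (auto simp: core_point_def intro!: divide_strict_left_mono)

lemma card_core_class: "card (core_class r :: (real ^ 'n::finite) set) = r - 1"
proof -
  have "inj_on (core_point :: nat \<Rightarrow> real ^ 'n) {..<r - 1}"
    by (auto simp: inj_on_def core_point_def vec_eq_iff)
  then show ?thesis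
    by (simp add: core_class_def card_image)
qed

lemma axis_class_disjoint: "a \<noteq> b \<Longrightarrow> axis_class r a \<inter> axis_class r b = {}"
  by (auto simp: axis_class_def axis_eq_axis)

lemma core_class_disjoint: "core_class r \<inter> axis_class r a = {}"
proof -
  have "core_point m \<noteq> axis a (alt n)" for m n
  proof
    assume "core_point m = axis a (alt n)"
    then have "alt n = core_point m $ a" by simp
    moreover have "1 / real CARD('a) \<le> 1" by simp
    ultimately show False
      using core_point_bounds[of m a] abs_alt[of n] by linarith
  qed
  then show ?thesis
    by (auto simp: core_class_def axis_class_def)
qed

text \<open>Choosing a point of \<open>T\<close> in each member is injective by disjointness. This
  pigeonhole serves twice: to find a set that misses the core, and to count the sets that need a
  point on one half-axis.\<close>

lemma card_le_if_disjoint_family_meets: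
  assumes "disjoint_family_on X I" "finite T" "\<And>i. i \<in> I \<Longrightarrow> X i \<inter> T \<noteq> {}"
  shows "card I \<le> card T"
proof -
  from assms(3) have "\<forall>i\<in>I. \<exists>p. p \<in> X i \<inter> T"
    by blast
  then obtain f where f: "\<And>i. i \<in> I \<Longrightarrow> f i \<in> X i \<inter> T"
    by (rule bchoice[THEN exE]) blast
  have "inj_on f I"
    using assms(1) f unfolding inj_on_def disjoint_family_on_def by fastforce
  then show ?thesis
    using assms(2) f by (intro card_inj_on_le[of f]) auto
qed

text \<open>A closed half-space is convex, so the inequality passes from \<open>S\<close> to
  \<open>x\<close>. The \<open>CARD('n)\<close> summands of \<open>v \<bullet> x\<close> then total
  at least 1, and they cannot all lie below the average.\<close>

lemma convex_hull_large_coordinate: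
  fixes v :: "real ^ 'n::finite"
  assumes "x \<in> convex hull S" "\<And>p. p \<in> S \<Longrightarrow> v \<bullet> p \<ge> 1"
  obtains a where "v $ a * x $ a \<ge> 1 / real CARD('n)"
proof -
  have "convex hull S \<subseteq> {p. v \<bullet> p \<ge> 1}"
    using assms(2) by (intro hull_minimal convex_halfspace_ge) auto
  with assms(1) have "1 \<le> (\<Sum>a\<in>UNIV. v $ a * x $ a)"
    by (auto simp: inner_vec_def)
  moreover have "(\<Sum>a\<in>UNIV. v $ a * x $ a) < real CARD('n) * (1 / real CARD('n))"
    if "\<And>a. v $ a * x $ a < 1 / real CARD('n)"
    using that by (intro sum_bounded_above_strict) auto
  ultimately show thesis
    using that by (force simp: not_le)
qed

text \<open>Otherwise \<open>S\<close>, and with it the hull, would lie in an open half-space that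
  excludes \<open>x\<close>; \<open>axis a s\<close> is the normal vector that reads off
  \<open>s\<close> times coordinate \<open>a\<close>.\<close>

lemma convex_hull_coordinate_witness:
  fixes x :: "real ^ 'n::finite"
  assumes "x \<in> convex hull S" "s * x $ a \<ge> c"
  obtains p where "p \<in> S" "s * p $ a \<ge> c"
proof (rule ccontr)
  assume "\<not> thesis"
  with that have "S \<subseteq> {p. axis a s \<bullet> p < c}"
    by (force simp: inner_axis' not_le)
  then have "convex hull S \<subseteq> {p. axis a s \<bullet> p < c}"
    by (intro hull_minimal convex_halfspace_lt)
  with assms show False
    by (force simp: inner_axis')
qed

lemma far_point_on_half_axis:
  fixes p :: "real ^ 'n::finite"
  assumes p: "p \<in> core_class r \<union> (\<Union>b. axis_class r b)"
    and s: "s \<in> {1, -1}" and far: "s * p $ a \<ge> 1 / real CARD('n)"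
  shows "p \<in> (\<lambda>m. axis a (alt m)) ` {m. m < r \<and> s * alt m > 0}"
proof -
  have pos: "s * p $ a > 0"
    using far by (rule less_le_trans[rotated]) simp
  have "p \<notin> core_class r"
  proof
    assume "p \<in> core_class r"
    then obtain m where "p = core_point m"
      by (auto simp: core_class_def)
    \<comment> \<open>For \<open>s = 1\<close> the coordinate is too small, for
      \<open>s = -1\<close> the product is negative.\<close>
    with s far pos core_point_bounds[of m a] show False
      by auto
  qed
  with p obtain b m where p: "p = axis b (alt m)" "m < r"
    by (auto simp: axis_class_def)
  with pos have "b = a"
    by (auto simp: axis_def split: if_splits)
  with p pos show ?thesis
    by auto
qed

text \<open>The vector \<open>v\<close> is normal to a facet of the cross-polytope: on each axis it
  takes the sign of the only point of \<open>S\<close> there, or any sign if there is none. Then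
  \<open>v \<bullet> p\<close> is the distance of \<open>p\<close> from the origin.\<close>

lemma rainbow_axis_signs:
  assumes sub: "S \<subseteq> (\<Union>a. axis_class r a)"
    and rainbow: "\<And>a. card (S \<inter> axis_class r a) \<le> 1"
  obtains v :: "real ^ 'n::finite"
  where "\<And>a. v $ a \<in> {1, -1}" "\<And>p. p \<in> S \<Longrightarrow> v \<bullet> p \<ge> 1"
proof -
  have "\<exists>s\<in>{1, -1::real}. \<forall>m<r. axis a (alt m) \<in> S \<longrightarrow> s * alt m \<ge> 1" for a
  proof (cases "\<exists>m<r. axis a (alt m) \<in> S")
    case True
    then obtain m where m: "m < r" "axis a (alt m) \<in> S" by blast
    have "n = m" if "n < r" "axis a (alt n) \<in> S" for n
    proof -
      \<comment> \<open>Finiteness is what turns the bound on \<open>card\<close> into uniqueness,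
        since infinite sets have \<open>card\<close> 0.\<close>
      have "finite (S \<inter> axis_class r a)"
        by (simp add: axis_class_def)
      then have "axis a (alt n) = axis a (alt m)"
        using rainbow[of a] m that card_le_Suc0_iff_eq[of "S \<inter> axis_class r a"]
        by (auto simp: axis_class_def)
      then show ?thesis
        using injD[OF inj_alt] by (auto simp: axis_eq_axis)
    qed
    moreover have "sgn (alt m) * alt m \<ge> 1"
      using abs_alt[of m] by (simp add: abs_sgn mult.commute)
    moreover have "sgn (alt m) \<in> {1, -1}"
      by (auto simp: sgn_real_def)
    ultimately show ?thesis by metis
  qed blast
  then obtain s :: "'n \<Rightarrow> real" where s: "\<And>a. s a \<in> {1, -1}"
    "\<And>a m. m < r \<Longrightarrow> axis a (alt m) \<in> S \<Longrightarrow> s a * alt m \<ge> 1"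
    by metis
  show thesis
  proof (rule that[of "\<chi> a. s a"])
    fix p assume "p \<in> S"
    with sub obtain a m where "p = axis a (alt m)" "m < r"
      by (auto simp: axis_class_def)
    with s(2) \<open>p \<in> S\<close> show "(\<chi> a. s a) \<bullet> p \<ge> 1"
      by (simp add: inner_axis)
  qed (use s(1) in auto)
qed

lemma rainbow_hulls_empty_Inter:
  fixes X :: "'i \<Rightarrow> (real ^ 'n::finite) set"
  assumes disj: "disjoint_family_on X I"
    and sub: "\<And>i. i \<in> I \<Longrightarrow> X i \<subseteq> core_class r \<union> (\<Union>a. axis_class r a)"
    and rainbow: "\<And>a. card (X i\<^sub>0 \<inter> axis_class r a) \<le> 1"
    and i\<^sub>0: "i\<^sub>0 \<in> I" "X i\<^sub>0 \<inter> core_class r = {}"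
    and large: "(r + 1) div 2 < card I"
  shows "(\<Inter>i\<in>I. convex hull (X i)) = {}"
proof (rule ccontr)
  assume "(\<Inter>i\<in>I. convex hull (X i)) \<noteq> {}"
  then obtain x where x: "\<And>i. i \<in> I \<Longrightarrow> x \<in> convex hull (X i)" by auto
  have "X i\<^sub>0 \<subseteq> (\<Union>a. axis_class r a)"
    using sub[OF i\<^sub>0(1)] i\<^sub>0(2) by blast
  then obtain v where v: "\<And>a. v $ a \<in> {1, -1}" "\<And>p. p \<in> X i\<^sub>0 \<Longrightarrow> v \<bullet> p \<ge> 1"
    using rainbow by (rule rainbow_axis_signs) blast
  obtain a where a: "v $ a * x $ a \<ge> 1 / real CARD('n)"
    using x[OF i\<^sub>0(1)] v(2) by (rule convex_hull_large_coordinate)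
  let ?M = "{m. m < r \<and> v $ a * alt m > 0}"
  let ?T = "(\<lambda>m. axis a (alt m)) ` ?M"
  \<comment> \<open>The coordinate \<open>a\<close> and its sign come from
    \<open>X i\<^sub>0\<close> alone, but \<open>x\<close> is common to all hulls, so every member
    must reach as far in that direction.\<close>
  have "X i \<inter> ?T \<noteq> {}" if i: "i \<in> I" for i
  proof -
    obtain p where p: "p \<in> X i" "v $ a * p $ a \<ge> 1 / real CARD('n)"
      using x[OF i] a by (rule convex_hull_coordinate_witness)
    then have "p \<in> ?T"
      using sub[OF i] v(1) by (intro far_point_on_half_axis) auto
    with p show ?thesis by blast
  qed
  then have "card I \<le> card ?T"
    using disj by (intro card_le_if_disjoint_family_meets) auto
  also have "\<dots> \<le> card ?M"
    by (intro card_image_le) simp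
  also have "\<dots> \<le> (r + 1) div 2"
    using v(1) by (rule card_alt_sign)
  finally show False using large by simp
qed

theorem theorem3p2:
  fixes r k :: nat
  assumes "r \<ge> 2"
    and "\<lceil>real r / 2\<rceil> < int k"
    and "k \<le> r"
  shows "\<exists>C :: nat \<Rightarrow> (real ^ 'n) set.
    disjoint_family_on C {0..CARD('n)} \<and>
    (\<forall>j\<in>{0..CARD('n)}. finite (C j)) \<and>
    (\<forall>j\<in>{1..CARD('n)}. card (C j) = r) \<and>
    card (C 0) = r - 1 \<and>
    (\<forall>X :: nat \<Rightarrow> (real ^ 'n) set.
      disjoint_family_on X {1..r} \<longrightarrow>
      (\<forall>i\<in>{1..r}. X i \<subseteq> (\<Union>j\<in>{0..CARD('n)}. C j)) \<longrightarrow>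
      (\<forall>i\<in>{1..r}. \<forall>j\<in>{0..CARD('n)}. card (X i \<inter> C j) \<le> 1) \<longrightarrow>
      (\<exists>I. I \<subseteq> {1..r} \<and> card I = k \<and> (\<Inter>i\<in>I. convex hull (X i)) = {}))"
proof -
  obtain b :: "nat \<Rightarrow> 'n" where b: "bij_betw b {1..CARD('n)} UNIV"
    using finite_same_card_bij[of "{1..CARD('n)}" "UNIV :: 'n set"] by auto
  define C :: "nat \<Rightarrow> (real ^ 'n) set"
    where "C j = (if j = 0 then core_class r else axis_class r (b j))" for j
  have axis_C: "\<exists>j\<in>{0..CARD('n)}. axis_class r a = C j" for a
  proof -
    from b obtain j where "j \<in> {1..CARD('n)}" "a = b j"
      by (metis UNIV_I bij_betw_imp_surj_on imageE)
    then show ?thesis by (intro bexI[of _ j]) (auto simp: C_def)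
  qed
  have Union_C: "(\<Union>j\<in>{0..CARD('n)}. C j) \<subseteq> core_class r \<union> (\<Union>a. axis_class r a)"
    by (auto simp: C_def split: if_splits)
  \<comment> \<open>For natural \<open>r\<close>, the ceiling of r/2 equals
    \<open>(r + 1) div 2\<close>.\<close>
  have k: "(r + 1) div 2 < k"
    using assms(2) by linarith
  show ?thesis
  proof (intro exI[of _ C] conjI ballI allI impI)
    show "disjoint_family_on C {0..CARD('n)}"
      unfolding disjoint_family_on_def
    proof (intro ballI impI)
      fix i j assume ij: "i \<in> {0..CARD('n)}" "j \<in> {0..CARD('n)}" "i \<noteq> j"
      then have "axis_class r (b i) \<inter> axis_class r (b j) = {}" if "i \<noteq> 0" "j \<noteq> 0"
        using that bij_betw_imp_inj_on[OF b]
        by (intro axis_class_disjoint) (auto dest: inj_onD)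
      with ij(3) show "C i \<inter> C j = {}"
        using core_class_disjoint[of r] by (auto simp: C_def Int_commute)
    qed
    show "finite (C j)" for j
      by (simp add: C_def core_class_def axis_class_def)
    show "card (C j) = r" if "j \<in> {1..CARD('n)}" for j
      using that by (simp add: C_def card_axis_class)
    show "card (C 0) = r - 1"
      by (simp add: C_def card_core_class)
  next
    fix X :: "nat \<Rightarrow> (real ^ 'n) set"
    assume disj: "disjoint_family_on X {1..r}"
      and sub: "\<forall>i\<in>{1..r}. X i \<subseteq> (\<Union>j\<in>{0..CARD('n)}. C j)"
      and rainbow: "\<forall>i\<in>{1..r}. \<forall>j\<in>{0..CARD('n)}. card (X i \<inter> C j) \<le> 1"
    \<comment> \<open>The core has only \<open>r - 1\<close> points, so \<open>r\<close> disjoint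
      sets cannot all meet it.\<close>
    obtain i\<^sub>0 where i\<^sub>0: "i\<^sub>0 \<in> {1..r}" "X i\<^sub>0 \<inter> core_class r = {}"
    proof (rule ccontr)
      assume "\<not> thesis"
      with that have "card {1..r} \<le> card (core_class r :: (real ^ 'n) set)"
        using disj by (intro card_le_if_disjoint_family_meets)
          (auto simp: core_class_def)
      with \<open>r \<ge> 2\<close> show False by (simp add: card_core_class)
    qed
    \<comment> \<open>Any \<open>k\<close> indices that include \<open>i\<^sub>0\<close> will
      do.\<close>
    have "card {i\<^sub>0} \<le> k" "k \<le> card {1..r}"
      using k \<open>k \<le> r\<close> by auto
    then obtain I where I: "{i\<^sub>0} \<subseteq> I" "I \<subseteq> {1..r}" "card I = k"
      using exists_subset_between[of "{i\<^sub>0}" k "{1..r}"] i\<^sub>0(1) by auto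
    have "(\<Inter>i\<in>I. convex hull (X i)) = {}"
    proof (rule rainbow_hulls_empty_Inter)
      show "disjoint_family_on X I"
        using disj I(2) by (rule disjoint_family_on_mono[rotated])
      show "X i \<subseteq> core_class r \<union> (\<Union>a. axis_class r a)" if "i \<in> I" for i
        using that I(2) sub Union_C by blast
      show "card (X i\<^sub>0 \<inter> axis_class r a) \<le> 1" for a
        using axis_C[of a] rainbow i\<^sub>0(1) by auto
    qed (use i\<^sub>0 I k in auto)
    with I show "\<exists>I. I \<subseteq> {1..r} \<and> card I = k \<and> (\<Inter>i\<in>I. convex hull (X i)) = {}"
      by blast
  qed
qed

end
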